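(* There is an algorithm (called LearnVal) which, interacting with the consumer only through price queries, after at most $O(n\log((1-\delta)/\delta^2))$ price queries outputs the ratio $v_i/v_n$ for every good $i$ except those goods that will be bought by the consumer under all price vectors.
   Context: There are $n$ divisible goods. A bundle is a vector $x\in[0,1]^n$ and a price vector is $p\in[0,1]^n$. A consumer has a known budget $B\ge 0$ and an unknown linear utility function $u(x)=x\cdot v$, where each $v_i\in\{\delta,2\delta,\ldots,1\}$ for a known discretization parameter $\delta>0$. Facing prices $p$, the consumer buys a bundle in $X(u,p,B)=\arg\max_{x\in[0,1]^n,\ x\cdot p\le B}u(x)$. A price query consists of the algorithm choosing a price vector $p\in[0,1]^n$ and observing the bundle $x\in X(u,p,B)$ purchased by the consumer. The goods are indexed so that $v_1>v_2>\cdots>v_n$ (this ordering is unknown to the algorithm), so $v_n$ is the smallest valuation coefficient.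
   Formalization: The budget is assumed to satisfy B > 0 instead of B ≥ 0: for B = 0 the consumer buys exactly the goods of price 0 whatever the valuations are, so for n ≥ 2 the ratios cannot be learned although no good is bought under all prices. *)

theory Defs
  imports Complex_Main "HOL-Library.FuncSet"
begin

text \<open>
  The number of goods has to vary inside the statement, since the constant hidden in the
  \<open>O\<close>-notation must not depend on it.  Vectors are therefore functions on the set of labels
  \<open>{1..n}\<close>; bundles and price vectors are extensional, so that equality of functions is
  equality of vectors.
\<close>

definition unit_cube :: "nat \<Rightarrow> (nat \<Rightarrow> real) set" where
  "unit_cube n = {1..n} \<rightarrow>\<^sub>E {0..1}"

definition dot :: "nat \<Rightarrow> (nat \<Rightarrow> real) \<Rightarrow> (nat \<Rightarrow> real) \<Rightarrow> real" where
  "dot n x y = (\<Sum>i=1..n. x i * y i)"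

definition demand ::
  "nat \<Rightarrow> ((nat \<Rightarrow> real) \<Rightarrow> real) \<Rightarrow> (nat \<Rightarrow> real) \<Rightarrow> real \<Rightarrow> (nat \<Rightarrow> real) set" where
  "demand n u p B = {x. is_arg_max u (\<lambda>x. x \<in> unit_cube n \<and> dot n x p \<le> B) x}"

text \<open>
  The grid \<open>{\<delta>, 2\<delta>, \<dots>, 1}\<close>.  It has this form, ending in \<open>1\<close>, only if \<open>1\<close> is a multiple
  of \<open>\<delta>\<close>; that is expressed by the separate condition \<open>1 \<in> grid \<delta>\<close>.
\<close>

definition grid :: "real \<Rightarrow> real set" where
  "grid \<delta> = {real k * \<delta> | k. 1 \<le> k \<and> real k * \<delta> \<le> 1}"

text \<open>
  Deterministic adaptive algorithms that access the consumer through price queries only,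
  as decision trees: either stop and report for each good a ratio or nothing, or post prices and
  continue depending on the observed bundle.  The number of queries on a path is not bounded
  a priori, but every path is finite.
\<close>

datatype algorithm =
    Output "nat \<Rightarrow> real option"
  | Query "nat \<Rightarrow> real" "(nat \<Rightarrow> real) \<Rightarrow> algorithm"

primrec admissible :: "nat \<Rightarrow> algorithm \<Rightarrow> bool" where
  "admissible n (Output out) \<longleftrightarrow> True"
| "admissible n (Query p next_step) \<longleftrightarrow>
     p \<in> unit_cube n \<and> (\<forall>x. admissible n (next_step x))"

text \<open>
  \<open>interaction n u B alg q out\<close>: against a consumer with utility \<open>u\<close> and budget \<open>B\<close>, the
  algorithm may halt after exactly \<open>q\<close> queries with output \<open>out\<close>.  Ties in the consumer's choice
  are broken arbitrarily, possibly differently each time the same prices are posted.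
\<close>

inductive interaction ::
  "nat \<Rightarrow> ((nat \<Rightarrow> real) \<Rightarrow> real) \<Rightarrow> real \<Rightarrow> algorithm \<Rightarrow> nat \<Rightarrow> (nat \<Rightarrow> real option) \<Rightarrow> bool"
  for n u B where
  stop: "interaction n u B (Output out) 0 out"
| step: "x \<in> demand n u p B \<Longrightarrow> interaction n u B (next_step x) q out
    \<Longrightarrow> interaction n u B (Query p next_step) (Suc q) out"

text \<open>
  Goods are divisible; a good counts as bought here only if the whole unit is bought, and this
  has to hold for every optimal bundle.  This is the narrowest reading, i.e. the one that
  excepts the fewest goods: a good bought under all prices in this sense is also bought under
  all prices in the sense of \<open>x i > 0\<close>, and for any rule of breaking ties.
\<close>

definition always_bought :: "nat \<Rightarrow> ((nat \<Rightarrow> real) \<Rightarrow> real) \<Rightarrow> real \<Rightarrow> nat \<Rightarrow> bool" where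
  "always_bought n u B i \<longleftrightarrow> (\<forall>p \<in> unit_cube n. \<forall>x \<in> demand n u p B. x i = 1)"

text \<open>
  The order of the goods by value is unknown to the algorithm, so the labels \<open>{1..n}\<close> it uses
  are not assumed to be sorted: the strict ordering \<open>v\<^sub>1 > \<dots> > v\<^sub>n\<close> up to relabelling is
  injectivity of \<open>v\<close>, and \<open>v\<^sub>n\<close> is the following value.
\<close>

definition least_value :: "nat \<Rightarrow> (nat \<Rightarrow> real) \<Rightarrow> real" where
  "least_value n v = Min (v ` {1..n})"

end

theory Submission
  imports Defs
begin

text \<open>
  The algorithm maintains the set \<open>L\<close> of the lowest goods, whose ratios \<open>r\<^sub>j = v\<^sub>j / v\<^sub>n\<close> it knows,
  and finds the lowest of the \<open>m\<close> remaining goods, \<open>i\<close>, together with \<open>T = v\<^sub>n / v\<^sub>i\<close>.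
  It posts the price \<open>t r\<^sub>j\<close> for every \<open>j \<in> L\<close>, which makes these goods equally attractive, and \<open>1\<close>
  for all the others.  Unless the whole supply is affordable, the bundle shows whether the
  goods in \<open>L\<close> or the good \<open>i\<close> are preferred, that is, on which side of \<open>t\<close> the number \<open>T\<close> lies.
  Everything is affordable iff \<open>m + t R \<le> B\<close> with \<open>R\<close> the sum of the \<open>r\<^sub>j\<close>, and \<open>m + T R \<le> B\<close> is
  exactly the condition under which all remaining goods are always bought.  So one query at a
  \<open>t\<close> just above \<open>(B - m) / R\<close> either allows the algorithm to stop or reveals \<open>i\<close>, as the only remaining
  good not bought entirely, and then bisection determines \<open>T\<close>, because two
  distinct quotients of grid values are at least \<open>\<delta>\<^sup>2\<close> apart.  If the budget is too small
  for this (below \<open>m - 1/2\<close>), all prices are scaled down, which has the effect of a larger budget.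
\<close>

section \<open>Optimal bundles\<close>

lemma demandD:
  assumes "x \<in> demand n u p B"
  shows "x \<in> unit_cube n" "dot n x p \<le> B"
    and "\<And>y. y \<in> unit_cube n \<Longrightarrow> dot n y p \<le> B \<Longrightarrow> u y \<le> u x"
  using assms by (auto simp: demand_def is_arg_max_linorder)

lemma unit_cubeD:
  assumes "x \<in> unit_cube n" "i \<in> {1..n}"
  shows "0 \<le> x i" "x i \<le> 1"
  using assms by (auto simp: unit_cube_def dest!: PiE_mem)

lemma unit_cube_upd:
  assumes "x \<in> unit_cube n" "i \<in> {1..n}" "0 \<le> z" "z \<le> 1"
  shows "x(i := z) \<in> unit_cube n"
  using assms by (auto simp: unit_cube_def PiE_iff extensional_def)

lemma dot_upd:
  assumes "i \<in> {1..n}"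
  shows "dot n (x(i := z)) p = dot n x p + (z - x i) * p i"
proof -
  have "dot n (x(i := z)) p = z * p i + (\<Sum>j\<in>{1..n} - {i}. x j * p j)"
    using assms by (simp add: dot_def sum.remove[of _ i])
  moreover have "dot n x p = x i * p i + (\<Sum>j\<in>{1..n} - {i}. x j * p j)"
    using assms by (simp add: dot_def sum.remove[of _ i])
  ultimately show ?thesis by (simp add: algebra_simps)
qed

text \<open>Otherwise \<open>x i\<close> could be raised a little: prices are at most 1, so
  \<open>e\<close> extra units cost at most \<open>e\<close>, and the unspent money covers
  them.\<close>

lemma demand_exhausts_budget:
  assumes x: "x \<in> demand n (\<lambda>x. dot n x v) p B" and p: "p \<in> unit_cube n"
    and i: "i \<in> {1..n}" "x i < 1" "0 < v i"
  shows "dot n x p = B"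
proof (rule ccontr)
  note d = demandD[OF x]
  assume "dot n x p \<noteq> B"
  then have lt: "dot n x p < B" using d(2) by simp
  define e where "e = min (1 - x i) (B - dot n x p)"
  have e: "0 < e" "e \<le> 1 - x i" "e \<le> B - dot n x p"
    using i lt by (auto simp: e_def)
  let ?y = "x(i := x i + e)"
  have "?y \<in> unit_cube n"
    using e unit_cubeD[OF d(1) i(1)] by (intro unit_cube_upd d i) auto
  moreover have "e * p i \<le> e"
    using e unit_cubeD[OF p i(1)] by (intro mult_left_le) auto
  then have "dot n ?y p \<le> B"
    using e unfolding dot_upd[OF i(1)] add_diff_cancel_left' by linarith
  ultimately have "dot n ?y v \<le> dot n x v" by (rule d(3))
  then show False
    using e i by (simp only: dot_upd[OF i(1)]) (simp add: mult_le_0_iff)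
qed

text \<open>Giving up \<open>e * p i\<close> units of \<open>j\<close> for \<open>e * p j\<close>
  units of \<open>i\<close> leaves spending unchanged and changes utility by
  \<open>e * (v i * p j - v j * p i)\<close>, which cannot be positive. The product form also covers
  zero prices.\<close>

lemma demand_exchange:
  assumes x: "x \<in> demand n (\<lambda>x. dot n x v) p B" and p: "p \<in> unit_cube n"
    and i: "i \<in> {1..n}" "x i < 1" and j: "j \<in> {1..n}" "0 < x j"
  shows "v i * p j \<le> v j * p i"
proof (rule ccontr)
  note d = demandD[OF x]
  assume "\<not> ?thesis"
  then have lt: "v j * p i < v i * p j" by simp
  then have ij: "i \<noteq> j" by auto
  note pi = unit_cubeD[OF p i(1)] and pj = unit_cubeD[OF p j(1)]
  note xi = unit_cubeD[OF d(1) i(1)] and xj = unit_cubeD[OF d(1) j(1)]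
  \<comment> \<open>As prices are at most 1, both traded amounts are at most \<open>e\<close>, so
    neither coordinate leaves the unit interval.\<close>
  define e where "e = min (1 - x i) (x j)"
  have e: "0 < e" "e \<le> 1 - x i" "e \<le> x j"
    using i j by (auto simp: e_def)
  have ep: "0 \<le> e * p i" "e * p i \<le> e" "0 \<le> e * p j" "e * p j \<le> e"
    using e pi pj by (auto intro: mult_left_le)
  let ?z = "x(i := x i + e * p j)" and ?y = "x(i := x i + e * p j, j := x j - e * p i)"
  have y: "dot n ?y q = dot n x q + e * (p j * q i - p i * q j)" for q
    using ij by (simp only: dot_upd[OF i(1)] dot_upd[OF j(1)]) (simp add: algebra_simps)
  have "?z \<in> unit_cube n"
    using ep e xi by (intro unit_cube_upd d i) linarith+
  then have "?y \<in> unit_cube n"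
    using ep e xj ij by (intro unit_cube_upd[of ?z] j) linarith+
  moreover have "dot n ?y p \<le> B"
    using d(2) by (simp only: y) (simp add: algebra_simps)
  ultimately have "dot n ?y v \<le> dot n x v" by (rule d(3))
  then show False
    using e lt by (simp only: y) (simp add: mult_le_0_iff algebra_simps)
qed

text \<open>If \<open>k\<close> were not bought entirely, exchange against \<open>k\<close>, whose
  price is at most 1, would bound the price of every bought good \<open>j\<close> by
  \<open>v j / v k\<close>. Spending would then stay strictly below the sum, the strictness coming
  from \<open>k\<close> itself, although the budget has to be exhausted.\<close>

lemma always_boughtI:
  assumes k: "k \<in> {1..n}" and pos: "\<And>j. j \<in> {1..n} \<Longrightarrow> 0 < v j"
    and B: "(\<Sum>j=1..n. min 1 (v j / v k)) \<le> B"
  shows "always_bought n (\<lambda>x. dot n x v) B k"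
  unfolding always_bought_def
proof (intro ballI, rule ccontr)
  fix p x
  assume p: "p \<in> unit_cube n" and x: "x \<in> demand n (\<lambda>x. dot n x v) p B" and "x k \<noteq> 1"
  note d = demandD[OF x]
  have k1: "x k < 1" using unit_cubeD[OF d(1) k] \<open>x k \<noteq> 1\<close> by simp
  have "x j * p j \<le> min 1 (v j / v k)" if j: "j \<in> {1..n}" for j
  proof (cases "x j = 0")
    case True
    then show ?thesis using pos[OF j] pos[OF k] by simp
  next
    case False
    then have "0 < x j" using unit_cubeD[OF d(1) j] by simp
    from demand_exchange[OF x p k k1 j this] have "v k * p j \<le> v j * p k" .
    also have "\<dots> \<le> v j" using unit_cubeD[OF p k] pos[OF j] by (simp add: mult_left_le)
    finally have "p j \<le> v j / v k" using pos[OF k] by (simp add: field_simps)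
    moreover have "x j * p j \<le> p j" "p j \<le> 1"
      using unit_cubeD[OF d(1) j] unit_cubeD[OF p j] by (auto intro: mult_left_le_one_le)
    ultimately show ?thesis by simp
  qed
  moreover have "x k * p k < min 1 (v k / v k)"
  proof -
    have "x k * p k \<le> x k"
      using unit_cubeD[OF d(1) k] unit_cubeD[OF p k] by (intro mult_left_le) auto
    then show ?thesis using k1 pos[OF k] by simp
  qed
  ultimately have "dot n x p < (\<Sum>j=1..n. min 1 (v j / v k))"
    unfolding dot_def using k by (intro sum_strict_mono_ex1) blast+
  then show False
    using B demand_exhausts_budget[OF x p k k1 pos[OF k]] by simp
qed

section \<open>Quotients of grid values\<close>

lemma gridD:
  assumes "a \<in> grid \<delta>" "0 < \<delta>"
  shows "0 < a" "a \<le> 1"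
  using assms by (auto simp: grid_def)

lemma finite_grid:
  assumes "0 < \<delta>"
  shows "finite (grid \<delta>)"
proof (rule finite_subset)
  have "k \<le> nat \<lfloor>1 / \<delta>\<rfloor>" if "real k * \<delta> \<le> 1" for k
    using assms that by (simp add: le_nat_floor pos_le_divide_eq)
  then show "grid \<delta> \<subseteq> (\<lambda>k. real k * \<delta>) ` {..nat \<lfloor>1 / \<delta>\<rfloor>}"
    by (auto simp: grid_def)
qed simp

text \<open>Over the common denominator \<open>b * d\<close>, which is at most 1, the numerator
  \<open>c * b - a * d\<close> is a positive integer multiple of
  \<open>\<delta>\<^sup>2\<close>.\<close>

lemma grid_quotients_apart:
  assumes "a \<in> grid \<delta>" "b \<in> grid \<delta>" "c \<in> grid \<delta>" "d \<in> grid \<delta>" "0 < \<delta>"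
    and "a / b < c / d"
  shows "\<delta>\<^sup>2 \<le> c / d - a / b"
proof -
  obtain i j k l :: nat where e: "a = i * \<delta>" "b = j * \<delta>" "c = k * \<delta>" "d = l * \<delta>"
    using assms by (auto simp: grid_def)
  have pos: "0 < b" "b \<le> 1" "0 < d" "d \<le> 1" using assms gridD by blast+
  have "a * d < c * b" using assms(6) pos by (simp add: field_simps)
  then have "\<delta>\<^sup>2 * (real i * l) < \<delta>\<^sup>2 * (real k * j)"
    by (simp add: e power2_eq_square mult_ac)
  then have "real i * l < real k * j" by (simp add: mult_less_cancel_left)
  then have "i * l + 1 \<le> k * j"
    by (simp flip: of_nat_mult)
  then have "real i * l + 1 \<le> real k * j"
    by (metis of_nat_1 of_nat_add of_nat_le_iff of_nat_mult)
  then have "\<delta>\<^sup>2 * 1 \<le> \<delta>\<^sup>2 * (real k * j - real i * l)"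
    by (intro mult_left_mono) auto
  also have "\<dots> = c * b - a * d"
    by (simp add: e power2_eq_square algebra_simps)
  also have "\<dots> = (c / d - a / b) * (b * d)"
    using pos by (simp add: field_simps)
  finally have "\<delta>\<^sup>2 \<le> (c / d - a / b) * (b * d)" by simp
  also have "\<dots> \<le> (c / d - a / b) * 1"
    using pos assms by (intro mult_left_mono) (auto intro: mult_le_one)
  finally show ?thesis by simp
qed

section \<open>The algorithm\<close>

text \<open>Scaling prices by \<open>B / eff_budget B m\<close> acts like this budget. The value
  \<open>m - 1/2\<close> lies above \<open>m - 1\<close>, so money remains for the lowest of the
  \<open>m\<close> goods once the others are bought, and below \<open>m\<close>, so a raised budget
  never pays for all of them.\<close>

definition eff_budget :: "real \<Rightarrow> nat \<Rightarrow> real" where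
  "eff_budget B m = max B (real m - 1/2)"

text \<open>Clipping matters only for bundles that no consumer buys: it makes admissibility trivial.\<close>

definition prices :: "nat \<Rightarrow> real \<Rightarrow> nat set \<Rightarrow> (nat \<Rightarrow> real) \<Rightarrow> real \<Rightarrow> nat \<Rightarrow> real" where
  "prices n B L r t = (\<lambda>j\<in>{1..n}.
     max 0 (min 1 (B / eff_budget B (card ({1..n} - L)) * (if j \<in> L then t * r j else 1))))"

definition prefers_known :: "nat \<Rightarrow> nat set \<Rightarrow> (nat \<Rightarrow> real) \<Rightarrow> bool" where
  "prefers_known n L x \<longleftrightarrow> (\<exists>k\<in>{1..n} - L. x k < 1) \<and> (\<exists>j\<in>L. 0 < x j)"

definition unsated :: "nat \<Rightarrow> nat set \<Rightarrow> (nat \<Rightarrow> real) \<Rightarrow> nat" where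
  "unsated n L x = (SOME k. k \<in> {1..n} - L \<and> x k < 1)"

text \<open>The solution \<open>t\<close> of \<open>m + t * R = eff_budget B m\<close>, cut off at 0
  because only positive levels can equal \<open>T\<close>.\<close>

definition affordable_level :: "nat \<Rightarrow> real \<Rightarrow> nat set \<Rightarrow> (nat \<Rightarrow> real) \<Rightarrow> real" where
  "affordable_level n B L r =
     (let m = card ({1..n} - L) in max 0 ((eff_budget B m - real m) / sum r L))"

text \<open>
  The third conjunct makes the lowest remaining good the only one of them not bought entirely;
  by the fourth, \<open>T \<le> t\<close> implies that \<open>T\<close> is at most the affordable level.
\<close>

definition is_first_level ::
  "nat \<Rightarrow> real \<Rightarrow> real \<Rightarrow> nat set \<Rightarrow> (nat \<Rightarrow> real) \<Rightarrow> real \<Rightarrow> bool" where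
  "is_first_level n \<delta> B L r t \<longleftrightarrow>
     affordable_level n B L r < t \<and> t < 1 / Max (r ` L) \<and>
     t * sum r L < eff_budget B (card ({1..n} - L)) - real (card ({1..n} - L)) + 1 \<and>
     (\<forall>a\<in>grid \<delta>. \<forall>b\<in>grid \<delta>. a / b \<le> affordable_level n B L r \<or> t < a / b)"

definition first_level :: "nat \<Rightarrow> real \<Rightarrow> real \<Rightarrow> nat set \<Rightarrow> (nat \<Rightarrow> real) \<Rightarrow> real" where
  "first_level n \<delta> B L r = (SOME t. is_first_level n \<delta> B L r t)"

text \<open>The bounds enclose \<open>T\<close>, the reciprocal of the ratio to be reported.\<close>

definition ratio_between :: "real \<Rightarrow> real \<Rightarrow> real \<Rightarrow> real" where
  "ratio_between \<delta> lo hi =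
     (SOME \<rho>. \<exists>a\<in>grid \<delta>. \<exists>b\<in>grid \<delta>. \<rho> = b / a \<and> lo \<le> a / b \<and> a / b \<le> hi)"

text \<open>Enough halvings to shrink an interval of length at most 1 below
  \<open>\<delta>\<^sup>2\<close>; the added 1 makes the inequality strict.\<close>

definition bisections :: "real \<Rightarrow> nat" where
  "bisections \<delta> = nat \<lceil>log 2 (1 / \<delta>\<^sup>2)\<rceil> + 1"

text \<open>The continuation attaches the rest of the decision tree below the leaves of the
  bisection.\<close>

primrec bisect :: "nat \<Rightarrow> real \<Rightarrow> nat set \<Rightarrow> (nat \<Rightarrow> real) \<Rightarrow> nat \<Rightarrow> real \<Rightarrow> real
    \<Rightarrow> (real \<Rightarrow> real \<Rightarrow> algorithm) \<Rightarrow> algorithm" where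
  "bisect n B L r 0 lo hi cont = cont lo hi"
| "bisect n B L r (Suc k) lo hi cont =
     Query (prices n B L r ((lo + hi) / 2)) (\<lambda>x.
       if prefers_known n L x then bisect n B L r k ((lo + hi) / 2) hi cont
       else bisect n B L r k lo ((lo + hi) / 2) cont)"

definition report :: "nat set \<Rightarrow> (nat \<Rightarrow> real) \<Rightarrow> nat \<Rightarrow> real option" where
  "report L r j = (if j \<in> L then Some (r j) else None)"

primrec learn :: "nat \<Rightarrow> real \<Rightarrow> real \<Rightarrow> nat \<Rightarrow> nat set \<Rightarrow> (nat \<Rightarrow> real) \<Rightarrow> algorithm" where
  "learn n \<delta> B 0 L r = Output (report L r)"
| "learn n \<delta> B (Suc f) L r =
     (if 1 / Max (r ` L) \<le> affordable_level n B L r then Output (report L r)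
      else Query (prices n B L r (first_level n \<delta> B L r)) (\<lambda>x.
        if prefers_known n L x then
          bisect n B L r (bisections \<delta>) (first_level n \<delta> B L r) (1 / Max (r ` L))
            (\<lambda>lo hi. learn n \<delta> B f (insert (unsated n L x) L)
               (r(unsated n L x := ratio_between \<delta> lo hi)))
        else Output (report L r)))"

text \<open>
  A single good requires an algorithm without queries, because the bound is zero for \<open>\<delta> = 1\<close>
  (\<open>ln 0 = 0\<close>).
\<close>

definition learn_val :: "nat \<Rightarrow> real \<Rightarrow> real \<Rightarrow> algorithm" where
  "learn_val n \<delta> B =
     (if n = 1 then Output (\<lambda>_. Some 1)
      else if real n \<le> B then Output (\<lambda>_. None)
      else Query (prices n B {} (\<lambda>_. 1) 0)
        (\<lambda>x. learn n \<delta> B (n - 1) {unsated n {} x} (\<lambda>_. 1)))"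

lemma prices_in_unit_cube: "prices n B L r t \<in> unit_cube n"
  by (auto simp: prices_def unit_cube_def)

lemma admissible_bisect:
  assumes "\<And>lo hi. admissible n (cont lo hi)"
  shows "admissible n (bisect n B L r k lo hi cont)"
  using assms by (induction k arbitrary: lo hi) (auto simp: prices_in_unit_cube)

lemma admissible_learn: "admissible n (learn n \<delta> B f L r)"
  by (induction f arbitrary: L r) (auto simp: prices_in_unit_cube intro!: admissible_bisect)

lemma admissible_learn_val: "admissible n (learn_val n \<delta> B)"
  by (auto simp: learn_val_def prices_in_unit_cube admissible_learn)

section \<open>Correctness\<close>

locale consumer =
  fixes n :: nat and \<delta> B :: real and v :: "nat \<Rightarrow> real"
  assumes n_pos: "1 \<le> n" and \<delta>_pos: "0 < \<delta>" and B_pos: "0 < B"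
    and v_grid: "v \<in> {1..n} \<rightarrow> grid \<delta>" and v_inj: "inj_on v {1..n}"
begin

abbreviation "utility \<equiv> \<lambda>x. dot n x v"
abbreviation "v_min \<equiv> least_value n v"

lemma v_pos: "j \<in> {1..n} \<Longrightarrow> 0 < v j"
  using v_grid gridD \<delta>_pos by blast

lemma v_min_in: "v_min \<in> v ` {1..n}"
  unfolding least_value_def using n_pos by (intro Min_in) auto

lemma v_min_pos: "0 < v_min"
  using v_min_in v_pos by auto

lemma v_min_le: "j \<in> {1..n} \<Longrightarrow> v_min \<le> v j"
  unfolding least_value_def by simp

definition right_output :: "(nat \<Rightarrow> real option) \<Rightarrow> bool" where
  "right_output out \<longleftrightarrow> (\<forall>i\<in>{1..n}. out i = Some (v i / v_min) \<or>
     (out i = None \<and> always_bought n utility B i))"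

text \<open>Ranging over all interactions covers every way of breaking ties.\<close>

definition correct :: "algorithm \<Rightarrow> nat \<Rightarrow> bool" where
  "correct alg Q \<longleftrightarrow>
     (\<forall>q out. interaction n utility B alg q out \<longrightarrow> q \<le> Q \<and> right_output out)"

lemma correct_Output: "right_output out \<Longrightarrow> correct (Output out) Q"
  by (auto simp: correct_def elim: interaction.cases)

lemma correct_Query:
  assumes "\<And>x. x \<in> demand n utility p B \<Longrightarrow> correct (next_step x) Q"
  shows "correct (Query p next_step) (Suc Q)"
  unfolding correct_def
proof (intro allI impI)
  fix q out
  assume "interaction n utility B (Query p next_step) q out"
  then show "q \<le> Suc Q \<and> right_output out"
    using assms by cases (auto simp: correct_def)
qed

text \<open>The invariant is that \<open>T\<close> lies between the two ends. The comparisons are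
  weak, so an arbitrary answer at \<open>t = T\<close> does no harm.\<close>

lemma correct_bisect:
  assumes "lo \<le> T" "T \<le> hi"
    and "\<And>t x. lo \<le> t \<Longrightarrow> t \<le> hi \<Longrightarrow> x \<in> demand n utility (prices n B L r t) B \<Longrightarrow>
           if prefers_known n L x then t \<le> T else T \<le> t"
    and "\<And>lo' hi'. lo' \<le> T \<Longrightarrow> T \<le> hi' \<Longrightarrow> hi' - lo' = (hi - lo) / 2 ^ k \<Longrightarrow>
           correct (cont lo' hi') Q"
  shows "correct (bisect n B L r k lo hi cont) (k + Q)"
  using assms
proof (induction k arbitrary: lo hi)
  case 0
  then show ?case by simp
next
  case (Suc k)
  let ?mid = "(lo + hi) / 2"
  show ?case
    unfolding bisect.simps add_Suc
  proof (rule correct_Query)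
    fix x assume x: "x \<in> demand n utility (prices n B L r ?mid) B"
    have mid: "lo \<le> ?mid" "?mid \<le> hi" using Suc.prems by auto
    have D: "if prefers_known n L x then ?mid \<le> T else T \<le> ?mid"
      using Suc.prems(3)[OF mid x] .
    show "correct (if prefers_known n L x then bisect n B L r k ?mid hi cont
        else bisect n B L r k lo ?mid cont) (k + Q)"
    proof (cases "prefers_known n L x")
      case True
      have "correct (bisect n B L r k ?mid hi cont) (k + Q)"
      proof (rule Suc.IH)
        show "correct (cont lo' hi') Q"
          if "lo' \<le> T" "T \<le> hi'" "hi' - lo' = (hi - ?mid) / 2 ^ k" for lo' hi'
          using that by (intro Suc.prems(4)) (auto simp: field_simps)
      qed (use True D mid Suc.prems in auto)
      then show ?thesis using True by simp
    next
      case False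
      have "correct (bisect n B L r k lo ?mid cont) (k + Q)"
      proof (rule Suc.IH)
        show "correct (cont lo' hi') Q"
          if "lo' \<le> T" "T \<le> hi'" "hi' - lo' = (?mid - lo) / 2 ^ k" for lo' hi'
          using that by (intro Suc.prems(4)) (auto simp: field_simps)
      qed (use False D mid Suc.prems in auto)
      then show ?thesis using False by simp
    qed
  qed
qed

end

section \<open>The stage invariant and the affordability threshold\<close>

locale stage = consumer +
  fixes L :: "nat set" and r :: "nat \<Rightarrow> real"
  assumes L_sub: "L \<subseteq> {1..n}"
    and r_eq: "j \<in> L \<Longrightarrow> r j = v j / v_min"
    and L_lowest: "j \<in> L \<Longrightarrow> k \<in> {1..n} - L \<Longrightarrow> v j < v k"
begin

abbreviation "U \<equiv> {1..n} - L"
abbreviation "m \<equiv> card U"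
abbreviation "R \<equiv> sum r L"
abbreviation "\<beta> \<equiv> eff_budget B m"
abbreviation "t0 \<equiv> affordable_level n B L r"

lemma finite_L [simp]: "finite L"
  using L_sub finite_subset by blast

lemma r_ge_1: "j \<in> L \<Longrightarrow> 1 \<le> r j"
  using r_eq v_min_pos v_min_le L_sub by (auto simp: le_divide_eq)

lemma v_eq: "j \<in> L \<Longrightarrow> v j = r j * v_min"
  using r_eq v_min_pos by simp

lemma R_pos: "L \<noteq> {} \<Longrightarrow> 0 < R"
  using r_ge_1 by (intro sum_pos) force+

lemma \<beta>_ge: "B \<le> \<beta>" and \<beta>_gt: "real m - 1 < \<beta>" and \<beta>_pos: "0 < \<beta>"
  using B_pos by (auto simp: eff_budget_def)

lemma scale: "0 < B / \<beta>" "B / \<beta> \<le> 1"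
  using B_pos \<beta>_ge \<beta>_pos by auto

lemma t0_nonneg: "0 \<le> t0"
  by (simp add: affordable_level_def Let_def)

lemma above_t0:
  assumes "L \<noteq> {}" "t0 < t"
  shows "\<beta> < real m + t * R"
proof -
  have "(\<beta> - real m) / R < t" using assms(2) by (simp add: affordable_level_def Let_def)
  then show ?thesis using R_pos[OF assms(1)] by (simp add: field_simps)
qed

text \<open>A positive \<open>t\<close> below \<open>t0\<close> forces \<open>\<beta>\<close> above
  \<open>m\<close>, so the budget was not raised and \<open>\<beta>\<close> is \<open>B\<close>
  itself.\<close>

lemma below_t0:
  assumes "L \<noteq> {}" "0 < t" "t \<le> t0"
  shows "real m + t * R \<le> B"
proof -
  have t: "t \<le> (\<beta> - real m) / R" using assms by (simp add: affordable_level_def Let_def max_def split: if_splits)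
  then have "t * R \<le> \<beta> - real m" using R_pos[OF assms(1)] by (simp add: field_simps)
  moreover have "0 < t * R" using assms R_pos by simp
  ultimately show ?thesis by (auto simp: eff_budget_def max_def split: if_splits)
qed

text \<open>In the sum of \<open>always_boughtI\<close> each remaining good contributes at most 1
  and each known \<open>j\<close> at most \<open>v j / v i\<close>, which is
  \<open>T * r j\<close>.\<close>

lemma all_bought:
  assumes i: "i \<in> U" "\<And>k. k \<in> U \<Longrightarrow> v i \<le> v k"
    and B: "real m + v_min / v i * R \<le> B" and k: "k \<in> U"
  shows "always_bought n utility B k"
proof (rule always_boughtI)
  have pos: "0 < v i" "0 < v k" using i k v_pos by auto
  have "(\<Sum>j=1..n. min 1 (v j / v k)) =
      (\<Sum>j\<in>U. min 1 (v j / v k)) + (\<Sum>j\<in>L. min 1 (v j / v k))"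
    using L_sub by (intro sum.subset_diff) auto
  also have "\<dots> \<le> (\<Sum>j\<in>U. 1) + (\<Sum>j\<in>L. v_min / v i * r j)"
  proof (intro add_mono sum_mono)
    fix j assume j: "j \<in> L"
    have "v j / v k \<le> v j / v i"
      using i(2)[OF k] pos v_pos[of j] j L_sub by (intro divide_left_mono) auto
    then show "min 1 (v j / v k) \<le> v_min / v i * r j"
      using v_eq[OF j] by (simp add: mult.commute)
  qed simp
  also have "\<dots> \<le> B" using B by (simp add: sum_distrib_left)
  finally show "(\<Sum>j=1..n. min 1 (v j / v k)) \<le> B" .
qed (use k v_pos in auto)

lemma right_report:
  assumes "\<And>k. k \<in> U \<Longrightarrow> always_bought n utility B k"
  shows "right_output (report L r)"
  using assms r_eq by (auto simp: right_output_def report_def)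

lemma right_report_if_below:
  assumes "L \<noteq> {}" and i: "i \<in> U" "\<And>k. k \<in> U \<Longrightarrow> v i \<le> v k" and "v_min / v i \<le> t0"
  shows "right_output (report L r)"
proof (rule right_report)
  have "0 < v_min / v i" using v_min_pos v_pos i by simp
  from below_t0[OF assms(1) this assms(4)]
  show "always_bought n utility B k" if "k \<in> U" for k
    using all_bought[OF i _ that] by simp
qed

section \<open>What a single bundle reveals about the level \<open>t\<close>\<close>

context
  fixes t :: real and x :: "nat \<Rightarrow> real"
  assumes t: "0 \<le> t" "j \<in> L \<Longrightarrow> t * r j \<le> 1"
    and x: "x \<in> demand n utility (prices n B L r t) B"
begin

lemma price_U: "k \<in> U \<Longrightarrow> prices n B L r t k = B / \<beta>"
  using scale by (simp add: prices_def)

lemma price_L: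
  assumes "j \<in> L"
  shows "prices n B L r t j = B / \<beta> * (t * r j)"
proof -
  have "0 \<le> t * r j" using r_ge_1[OF assms] t by simp
  then have "0 \<le> B / \<beta> * (t * r j)" "B / \<beta> * (t * r j) \<le> 1"
    using scale t(2)[OF assms] by (auto intro!: mult_le_one simp del: times_divide_eq_left)
  then show ?thesis using assms L_sub by (auto simp: prices_def)
qed

lemma x_bounds: "j \<in> {1..n} \<Longrightarrow> 0 \<le> x j" "j \<in> {1..n} \<Longrightarrow> x j \<le> 1"
  using unit_cubeD demandD[OF x] by auto

lemma spending: "dot n x (prices n B L r t) = B / \<beta> * (sum x U + t * (\<Sum>j\<in>L. r j * x j))"
proof -
  have "dot n x (prices n B L r t) =
      (\<Sum>j\<in>U. x j * prices n B L r t j) + (\<Sum>j\<in>L. x j * prices n B L r t j)"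
    unfolding dot_def using L_sub by (intro sum.subset_diff) auto
  also have "(\<Sum>j\<in>U. x j * prices n B L r t j) = B / \<beta> * sum x U"
    unfolding sum_distrib_left by (intro sum.cong) (auto simp: price_U)
  also have "(\<Sum>j\<in>L. x j * prices n B L r t j) = B / \<beta> * (t * (\<Sum>j\<in>L. r j * x j))"
    unfolding sum_distrib_left by (intro sum.cong) (auto simp: price_L)
  finally show ?thesis by (simp add: distrib_left)
qed

lemma scale_cancel: "B / \<beta> * z \<le> B \<longleftrightarrow> z \<le> \<beta>" "B / \<beta> * z = B \<longleftrightarrow> z = \<beta>" for z
  using B_pos \<beta>_pos by (auto simp: field_simps)

lemma spending_le: "sum x U + t * (\<Sum>j\<in>L. r j * x j) \<le> \<beta>"
  using demandD(2)[OF x] by (simp only: spending scale_cancel)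

lemma spending_eq:
  assumes "k \<in> {1..n}" "x k < 1"
  shows "sum x U + t * (\<Sum>j\<in>L. r j * x j) = \<beta>"
  using demand_exhausts_budget[OF x prices_in_unit_cube assms v_pos[OF assms(1)]]
  by (simp only: spending scale_cancel)

lemma prefer_U_U:
  assumes "k \<in> U" "x k < 1" "l \<in> U" "0 < x l"
  shows "v k \<le> v l"
  using demand_exchange[OF x prices_in_unit_cube _ assms(2) _ assms(4)] assms scale
  by (simp add: price_U mult_le_cancel_right del: times_divide_eq_right)

text \<open>Known goods are priced in proportion to their values, so \<open>r j\<close> cancels and
  the comparison is the same for every \<open>j\<close> in \<open>L\<close>.\<close>

lemma prefer_U_L:
  assumes k: "k \<in> U" "x k < 1" and j: "j \<in> L" "0 < x j"
  shows "t \<le> v_min / v k"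
proof -
  have "B / \<beta> * (v k * t * r j) \<le> B / \<beta> * (v_min * r j)"
    using demand_exchange[OF x prices_in_unit_cube _ k(2) _ j(2)] k j L_sub
    by (auto simp: price_U price_L v_eq mult_ac)
  then have "v k * t \<le> v_min"
    using scale r_ge_1[OF j(1)] by (simp del: times_divide_eq_left)
  then show ?thesis using v_pos[of k] k by (simp add: field_simps)
qed

lemma prefer_L_U:
  assumes k: "k \<in> U" "0 < x k" and j: "j \<in> L" "x j < 1"
  shows "v_min / v k \<le> t"
proof -
  have "B / \<beta> * (v_min * r j) \<le> B / \<beta> * (v k * t * r j)"
    using demand_exchange[OF x prices_in_unit_cube _ j(2) _ k(2)] k j L_sub
    by (auto simp: price_U price_L v_eq mult_ac)
  then have "v_min \<le> v k * t"
    using scale r_ge_1[OF j(1)] by (simp del: times_divide_eq_left)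
  then show ?thesis using v_pos[of k] k by (simp add: field_simps)
qed

lemma spending_L_le: "t * (\<Sum>j\<in>L. r j * x j) \<le> t * R"
  using t L_sub x_bounds r_ge_1 by (intro mult_left_mono sum_mono mult_left_le) force+

lemma sum_U_le_without:
  assumes "i \<in> U" "x i = 0"
  shows "sum x U \<le> real m - 1"
proof -
  have "sum x U = sum x (U - {i})" using assms sum.remove[of U i x] by auto
  also have "\<dots> \<le> (\<Sum>j\<in>U - {i}. 1)" using x_bounds by (intro sum_mono) auto
  also have "\<dots> = real (card (U - {i}))" by simp
  also have "\<dots> = real m - 1"
    using assms card_gt_0_iff[of U] by (auto simp: card_Diff_singleton simp del: card_Diff_insert)
  finally show ?thesis .
qed

text \<open>If another good were unsated, exchange at equal prices would leave \<open>i\<close>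
  unbought. The other remaining goods and all of \<open>L\<close> together cost too little to
  exhaust the budget.\<close>

lemma unsated_lowest:
  assumes small: "t * R < \<beta> - real m + 1" and i: "i \<in> U" "\<And>k. k \<in> U \<Longrightarrow> v i \<le> v k"
    and k: "k \<in> U" "x k < 1"
  shows "k = i"
proof (rule ccontr)
  assume "k \<noteq> i"
  then have "v i \<noteq> v k" using inj_onD[OF v_inj, of i k] i(1) k(1) by auto
  then have "\<not> 0 < x i" using prefer_U_U[OF k i(1)] i(2)[OF k(1)] by auto
  then have "x i = 0" using x_bounds(1)[of i] i by simp
  then have "sum x U \<le> real m - 1" using sum_U_le_without i by simp
  moreover have "sum x U + t * (\<Sum>j\<in>L. r j * x j) = \<beta>" using spending_eq k by blast
  ultimately show False using spending_L_le small by linarith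
qed

lemma unsated_eq:
  assumes "t * R < \<beta> - real m + 1" and "i \<in> U" "\<And>k. k \<in> U \<Longrightarrow> v i \<le> v k"
    and "\<exists>k\<in>U. x k < 1"
  shows "unsated n L x = i"
proof -
  have "unsated n L x \<in> U \<and> x (unsated n L x) < 1"
    unfolding unsated_def by (rule someI_ex) (use assms(4) in auto)
  then show ?thesis using unsated_lowest[OF assms(1-3)] by blast
qed

lemma some_unsated:
  assumes "\<beta> < real m + t * R"
  shows "\<exists>k\<in>{1..n}. x k < 1"
proof (rule ccontr)
  assume "\<not> ?thesis"
  then have 1: "x j = 1" if "j \<in> {1..n}" for j using x_bounds(2)[OF that] that by force
  then have "sum x U = m" by simp
  moreover have "(\<Sum>j\<in>L. r j * x j) = R" using 1 L_sub by (intro sum.cong) auto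
  ultimately show False using spending_le assms by simp
qed

text \<open>Each answer yields a pair to exchange: \<open>i\<close> unsated against a bought known
  good, or \<open>i\<close> bought against an unsated known good. At \<open>t = T\<close> both
  answers are possible, hence the weak inequalities.\<close>

lemma prefers_known_iff:
  assumes "L \<noteq> {}" and big: "\<beta> < real m + t * R"
    and i: "i \<in> U" "\<And>k. k \<in> U \<Longrightarrow> v i \<le> v k"
  shows "if prefers_known n L x then t \<le> v_min / v i else v_min / v i \<le> t"
proof (cases "prefers_known n L x")
  case True
  then obtain k j where k: "k \<in> U" "x k < 1" and j: "j \<in> L" "0 < x j"
    by (auto simp: prefers_known_def)
  have "x i < 1"
  proof (rule ccontr)
    assume "\<not> x i < 1"
    then have "0 < x i" by simp
    then have "v k = v i" using prefer_U_U[OF k i(1)] i(2)[OF k(1)] by simp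
    then have "k = i" using inj_onD[OF v_inj, of i k] i(1) k(1) by auto
    then show False using k \<open>\<not> x i < 1\<close> by simp
  qed
  then show ?thesis using prefer_U_L[OF i(1) _ j] True by simp
next
  case False
  obtain l where l: "l \<in> {1..n}" "x l < 1" using some_unsated[OF big] by blast
  have "0 < x i \<and> (\<exists>j\<in>L. x j < 1)"
  \<comment> \<open>If a remaining good is unsated, nothing in \<open>L\<close> is bought, so all of
    \<open>\<beta> > m - 1\<close> goes to \<open>U\<close> and reaches \<open>i\<close>. Otherwise
    \<open>U\<close> is bought entirely and the unsated good lies in \<open>L\<close>.\<close>
  proof (cases "\<exists>k\<in>U. x k < 1")
    case True
    then have zero: "x j = 0" if "j \<in> L" for j
      using False that L_sub x_bounds(1)[of j] by (force simp: prefers_known_def)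
    then have sum: "sum x U = \<beta>" using spending_eq[OF l] by simp
    then have "x i \<noteq> 0" using sum_U_le_without[OF i(1)] \<beta>_gt by auto
    then have xi: "0 < x i" using x_bounds(1)[of i] i by simp
    show ?thesis using xi zero assms(1) by force
  next
    case F: False
    then have "l \<in> L" "\<not> x i < 1" using l i(1) by blast+
    then have "l \<in> L" "0 < x i" by simp_all
    then show ?thesis using l by blast
  qed
  then show ?thesis using prefer_L_U[OF i(1)] False by auto
qed

end

lemma stage_insert:
  assumes i: "i \<in> U" "\<And>k. k \<in> U \<Longrightarrow> v i \<le> v k"
  shows "stage n \<delta> B v (insert i L) (r(i := v i / v_min))"
proof unfold_locales
  fix j k assume j: "j \<in> insert i L" and k: "k \<in> {1..n} - insert i L"
  have "v i \<noteq> v k" using inj_onD[OF v_inj, of i k] i(1) k by auto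
  then show "v j < v k" using i(2)[of k] L_lowest[of j k] j k by fastforce
qed (use i L_sub r_eq in auto)

text \<open>Every condition holds immediately to the right of \<open>t0\<close>, and finiteness of
  the grid leaves only finitely many of them.\<close>

lemma is_first_level_ex:
  assumes "L \<noteq> {}" "t0 < 1 / Max (r ` L)"
  shows "is_first_level n \<delta> B L r (first_level n \<delta> B L r)"
proof -
  have below: "eventually (\<lambda>t. t < b) (at_right t0)" if "t0 < b" for b
    using that by (rule order_tendstoD(2)[OF tendsto_ident_at])
  have "t0 < (\<beta> - real m + 1) / R"
    using R_pos[OF assms(1)] \<beta>_gt by (simp add: affordable_level_def Let_def divide_strict_right_mono)
  then have R: "eventually (\<lambda>t. t * R < \<beta> - real m + 1) (at_right t0)"
    using below[of "(\<beta> - real m + 1) / R"] R_pos[OF assms(1)] by (simp add: pos_less_divide_eq)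
  have "eventually (\<lambda>t. a / b \<le> t0 \<or> t < a / b) (at_right t0)" for a b
    using below[of "a / b"] by (cases "a / b \<le> t0") auto
  then have "eventually (\<lambda>t. \<forall>a\<in>grid \<delta>. \<forall>b\<in>grid \<delta>. a / b \<le> t0 \<or> t < a / b) (at_right t0)"
    using finite_grid[OF \<delta>_pos] by (intro eventually_ball_finite ballI)
  then have "eventually (is_first_level n \<delta> B L r) (at_right t0)"
    using R below[OF assms(2)] eventually_at_right_less[of t0]
    by eventually_elim (simp add: is_first_level_def)
  then have "\<exists>t. is_first_level n \<delta> B L r t"
    by (rule eventually_happens'[OF trivial_limit_at_right_real])
  then show ?thesis unfolding first_level_def by (rule someI_ex)
qed

end

section \<open>Assembling the stages and counting queries\<close>

context consumer
begin

lemma lowest_ex: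
  assumes "A \<subseteq> {1..n}" "A \<noteq> {}"
  obtains i where "i \<in> A" "\<And>k. k \<in> A \<Longrightarrow> v i \<le> v k"
proof -
  have "finite A" using assms finite_subset by blast
  then have "Min (v ` A) \<in> v ` A" "\<And>k. k \<in> A \<Longrightarrow> Min (v ` A) \<le> v k"
    using assms by auto
  then show ?thesis using that by force
qed

text \<open>The true quotient is a candidate, and any other one would be at least
  \<open>\<delta>\<^sup>2\<close> away, outside the interval.\<close>

lemma ratio_between_eq:
  assumes i: "i \<in> {1..n}" and T: "lo \<le> v_min / v i" "v_min / v i \<le> hi" and "hi - lo < \<delta>\<^sup>2"
  shows "ratio_between \<delta> lo hi = v i / v_min"
proof -
  have grid: "v i \<in> grid \<delta>" "v_min \<in> grid \<delta>" using v_grid v_min_in i by auto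
  have "\<exists>a\<in>grid \<delta>. \<exists>b\<in>grid \<delta>. ratio_between \<delta> lo hi = b / a \<and> lo \<le> a / b \<and> a / b \<le> hi"
    unfolding ratio_between_def by (rule someI_ex) (use grid T in blast)
  then obtain a b where ab: "a \<in> grid \<delta>" "b \<in> grid \<delta>" "ratio_between \<delta> lo hi = b / a"
      "lo \<le> a / b" "a / b \<le> hi"
    by blast
  have "a / b = v_min / v i"
    using grid_quotients_apart[OF ab(1,2) grid(2,1) \<delta>_pos]
      grid_quotients_apart[OF grid(2,1) ab(1,2) \<delta>_pos] ab T assms(4)
    by linarith
  then have "inverse (a / b) = inverse (v_min / v i)" by simp
  then show ?thesis using ab by simp
qed

lemma bisections_suffice: "1 / 2 ^ bisections \<delta> < \<delta>\<^sup>2"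
proof -
  have "1 / \<delta>\<^sup>2 = 2 powr log 2 (1 / \<delta>\<^sup>2)" using \<delta>_pos by simp
  also have "\<dots> < 2 powr real (bisections \<delta>)"
    by (intro powr_less_mono) (auto simp: bisections_def, linarith)
  also have "\<dots> = 2 ^ bisections \<delta>" by (simp add: powr_realpow)
  finally show ?thesis using \<delta>_pos by (simp add: field_simps)
qed

text \<open>Each remaining good costs at most one query at the first level and
  \<open>bisections \<delta>\<close> further ones.\<close>

lemma correct_learn:
  assumes "stage n \<delta> B v L r" "L \<noteq> {}" "card ({1..n} - L) = f"
  shows "correct (learn n \<delta> B f L r) (f * Suc (bisections \<delta>))"
  using assms
proof (induction f arbitrary: L r)
  case 0
  interpret stage n \<delta> B v L r by fact
  have "U = {}" using 0 by simp
  then show ?case by (auto intro!: correct_Output right_report)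
next
  case (Suc f)
  interpret stage n \<delta> B v L r by fact
  have "U \<noteq> {}"
  proof
    assume "U = {}"
    then show False using Suc.prems(3) by (simp only: card.empty)
  qed
  then obtain i where i: "i \<in> U" "\<And>k. k \<in> U \<Longrightarrow> v i \<le> v k"
    using lowest_ex[of U] by blast
  let ?T = "v_min / v i" and ?t = "first_level n \<delta> B L r" and ?M = "Max (r ` L)"
  have Max: "r j \<le> ?M" if "j \<in> L" for j using that by simp
  obtain j0 where j0: "j0 \<in> L" using Suc.prems by blast
  have M: "1 \<le> ?M" using r_ge_1[OF j0] Max[OF j0] by simp
  have vi: "0 < v i" using v_pos i by simp
  have "?M \<in> r ` L" using Suc.prems by (intro Max_in) auto
  then obtain j where j: "j \<in> L" "?M = r j" by auto
  have "?M * ?T < 1"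
    using L_lowest[OF j(1) i(1)] vi v_eq[OF j(1)] j(2) by simp
  then have TM: "?T < 1 / ?M" using M by (simp add: field_simps)
  show ?case
  proof (cases "1 / ?M \<le> t0")
    case True
    then show ?thesis
      using right_report_if_below[OF Suc.prems(2) i] TM by (auto intro: correct_Output)
  next
    case False
    then have first: "is_first_level n \<delta> B L r ?t"
      using is_first_level_ex Suc.prems by simp
    have fl: "t0 < ?t" "?t < 1 / ?M" "?t * R < \<beta> - real m + 1"
      "\<And>a b. a \<in> grid \<delta> \<Longrightarrow> b \<in> grid \<delta> \<Longrightarrow> a / b \<le> t0 \<or> ?t < a / b"
      using first by (auto simp: is_first_level_def)
    have le1: "t * r j \<le> 1" if "j \<in> L" "t \<le> 1 / ?M" "0 \<le> t" for t j
    proof -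
      have "t * r j \<le> t * ?M" using that Max by (intro mult_left_mono) auto
      also have "\<dots> \<le> 1" using that M by (simp add: field_simps)
      finally show ?thesis .
    qed
    have t_pos: "0 < ?t" using fl(1) t0_nonneg by simp
    \<comment> \<open>Levels above \<open>t0\<close> make the whole supply unaffordable, and levels
      up to \<open>1 / ?M\<close> keep the prices unclipped.\<close>
    have test: "if prefers_known n L x then t \<le> ?T else ?T \<le> t"
      if "?t \<le> t" "t \<le> 1 / ?M" "x \<in> demand n utility (prices n B L r t) B" for t x
      using that t_pos fl(1)
      by (intro prefers_known_iff[OF _ le1 _ Suc.prems(2) above_t0[OF Suc.prems(2)] i]) auto
    have "correct (Query (prices n B L r ?t) (\<lambda>x.
        if prefers_known n L x then
          bisect n B L r (bisections \<delta>) ?t (1 / ?M)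
            (\<lambda>lo hi. learn n \<delta> B f (insert (unsated n L x) L)
               (r(unsated n L x := ratio_between \<delta> lo hi)))
        else Output (report L r))) (Suc (bisections \<delta> + f * Suc (bisections \<delta>)))"
    proof (rule correct_Query)
      fix x assume x: "x \<in> demand n utility (prices n B L r ?t) B"
      have D: "if prefers_known n L x then ?t \<le> ?T else ?T \<le> ?t"
        using test[OF _ _ x] fl by simp
      show "correct (if prefers_known n L x then
          bisect n B L r (bisections \<delta>) ?t (1 / ?M)
            (\<lambda>lo hi. learn n \<delta> B f (insert (unsated n L x) L)
               (r(unsated n L x := ratio_between \<delta> lo hi)))
        else Output (report L r)) (bisections \<delta> + f * Suc (bisections \<delta>))"
      proof (cases "prefers_known n L x")
        case True
        then have "\<exists>k\<in>U. x k < 1" by (auto simp: prefers_known_def)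
        then have ui: "unsated n L x = i"
          using t_pos fl(2,3) x by (intro unsated_eq[OF _ le1 _ _ i]) auto
        have "correct (bisect n B L r (bisections \<delta>) ?t (1 / ?M)
            (\<lambda>lo hi. learn n \<delta> B f (insert i L) (r(i := ratio_between \<delta> lo hi))))
            (bisections \<delta> + f * Suc (bisections \<delta>))"
        proof (rule correct_bisect[where T = ?T])
          fix lo hi
          assume T: "lo \<le> ?T" "?T \<le> hi"
            and len: "hi - lo = (1 / ?M - ?t) / 2 ^ bisections \<delta>"
          have "1 / ?M \<le> 1" using M by simp
          then have "1 / ?M - ?t \<le> 1" using t_pos by linarith
          then have "hi - lo \<le> 1 / 2 ^ bisections \<delta>"
            unfolding len by (intro divide_right_mono) auto
          then have "hi - lo < \<delta>\<^sup>2" using bisections_suffice by simp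
          then have "ratio_between \<delta> lo hi = v i / v_min"
            using ratio_between_eq[OF _ T] i by simp
          moreover have "card ({1..n} - insert i L) = f"
            using Suc.prems(3) i by (simp add: Diff_insert[of _ i L])
          ultimately show "correct (learn n \<delta> B f (insert i L) (r(i := ratio_between \<delta> lo hi)))
              (f * Suc (bisections \<delta>))"
            using stage_insert[OF i] by (intro Suc.IH) (auto simp del: fun_upd_apply simp: fun_upd_def)
        qed (use D True TM test in auto)
        then show ?thesis using True ui by simp
      next
        case no: False
        have "v i \<in> grid \<delta>" "v_min \<in> grid \<delta>" using v_grid v_min_in i by auto
        \<comment> \<open>The answer gives \<open>?T \<le> ?t\<close>, and no grid quotient lies
          above \<open>t0\<close> and at most at \<open>?t\<close>.\<close>
        then have "?T \<le> t0" using fl(4)[of v_min "v i"] D no by auto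
        then show ?thesis
          using right_report_if_below[OF Suc.prems(2) i] no by (auto intro: correct_Output)
      qed
    qed
    then show ?thesis using False by (simp add: add.left_commute)
  qed
qed

lemma correct_learn_val: "correct (learn_val n \<delta> B) (if n = 1 then 0 else n * Suc (bisections \<delta>))"
proof -
  consider "n = 1" | "n \<noteq> 1" "real n \<le> B" | "n \<noteq> 1" "B < real n" by linarith
  then show ?thesis
  proof cases
    case 1
    then have "v_min = v 1" "0 < v 1" using v_pos by (auto simp: least_value_def)
    then have "right_output (\<lambda>_. Some 1)" unfolding right_output_def using 1 by simp
    from correct_Output[OF this] show ?thesis using 1 by (simp add: learn_val_def)
  next
    case 2
    interpret stage n \<delta> B v "{}" "\<lambda>_. 1" by unfold_locales auto
    obtain i where i: "i \<in> {1..n}" "\<And>k. k \<in> {1..n} \<Longrightarrow> v i \<le> v k"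
      using lowest_ex[of "{1..n}"] n_pos by auto
    have "always_bought n utility B k" if "k \<in> {1..n}" for k
      using all_bought[of i k] i that 2 by simp
    then show ?thesis
      using 2 by (auto simp: learn_val_def right_output_def intro!: correct_Output)
  next
    case 3
    interpret stage n \<delta> B v "{}" "\<lambda>_. 1" by unfold_locales auto
    obtain i where i: "i \<in> {1..n}" "\<And>k. k \<in> {1..n} \<Longrightarrow> v i \<le> v k"
      using lowest_ex[of "{1..n}"] n_pos by auto
    have iU: "i \<in> {1..n} - {}" "\<And>k. k \<in> {1..n} - {} \<Longrightarrow> v i \<le> v k" using i by auto
    have vi: "v i = v_min"
      using i v_min_in v_min_le[OF i(1)] by force
    have "stage n \<delta> B v {i} (\<lambda>_. 1)"
      using stage_insert[OF iU] vi v_min_pos by (simp add: fun_upd_def)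
    moreover have "card ({1..n} - {i}) = n - 1" using i by simp
    ultimately have learn: "correct (learn n \<delta> B (n - 1) {i} (\<lambda>_. 1)) ((n - 1) * Suc (bisections \<delta>))"
      by (intro correct_learn) auto
    \<comment> \<open>With no good known yet, all prices are equal and \<open>\<beta> < n\<close>,
      so the only unsated good is the least valued one, whose ratio is 1.\<close>
    have "correct (Query (prices n B {} (\<lambda>_. 1) 0)
        (\<lambda>x. learn n \<delta> B (n - 1) {unsated n {} x} (\<lambda>_. 1))) (Suc ((n - 1) * Suc (bisections \<delta>)))"
    proof (rule correct_Query)
      fix x assume x: "x \<in> demand n utility (prices n B {} (\<lambda>_. 1) 0) B"
      have "\<beta> < real n" using 3 by (simp add: eff_budget_def)
      then have "\<exists>k\<in>{1..n}. x k < 1" using some_unsated[OF _ _ x] by simp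
      then have "unsated n {} x = i"
        using \<beta>_gt by (intro unsated_eq[OF _ _ x _ iU]) auto
      then show "correct (learn n \<delta> B (n - 1) {unsated n {} x} (\<lambda>_. 1)) ((n - 1) * Suc (bisections \<delta>))"
        using learn by simp
    qed
    moreover have "Suc ((n - 1) * Suc (bisections \<delta>)) \<le> n * Suc (bisections \<delta>)"
      using n_pos by (cases n) auto
    ultimately show ?thesis
      using 3 by (fastforce simp: learn_val_def correct_def)
  qed
qed

text \<open>For \<open>\<delta> = 1\<close> the grid is a single point, so injectivity forces
  \<open>n = 1\<close> and both sides vanish. Otherwise \<open>1 / \<delta>\<close> is an integer
  greater than 1, so \<open>\<delta> \<le> 1/2\<close>, which absorbs all additive constants into
  the logarithm.\<close>

lemma query_bound:
  assumes one: "1 \<in> grid \<delta>"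
  shows "real (if n = 1 then 0 else n * Suc (bisections \<delta>))
     \<le> 5 / ln 2 * (real n * ln ((1 - \<delta>) / \<delta>\<^sup>2))"
proof -
  obtain N :: nat where N: "1 \<le> N" "real N * \<delta> = 1" using one by (auto simp: grid_def)
  show ?thesis
  proof (cases "N = 1")
    case True
    then have \<delta>: "\<delta> = 1" using N by simp
    then have "v j = 1" if "j \<in> {1..n}" for j
    proof -
      have "v j \<in> grid 1" using v_grid that \<delta> by auto
      then obtain k :: nat where "v j = real k" "1 \<le> k" "real k \<le> 1"
        by (auto simp: grid_def)
      then show ?thesis by simp
    qed
    then have "n = 1"
      using inj_onD[OF v_inj, of 1 n] n_pos by simp
    then show ?thesis using \<delta> by simp
  next
    case False
    then have "2 * \<delta> \<le> real N * \<delta>" using N \<delta>_pos by (intro mult_right_mono) auto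
    then have half: "\<delta> \<le> 1 / 2" using N by simp
    define X where "X = (1 - \<delta>) / \<delta>\<^sup>2"
    have \<delta>2: "0 < \<delta>\<^sup>2" using \<delta>_pos by simp
    have inv: "1 / \<delta>\<^sup>2 \<le> 2 * X"
      using half \<delta>2 by (simp add: X_def divide_right_mono)
    have "\<delta>\<^sup>2 \<le> (1 / 2)\<^sup>2" using half \<delta>_pos by (intro power_mono) auto
    then have "4 \<le> 1 / \<delta>\<^sup>2" using \<delta>2 by (simp add: field_simps power2_eq_square)
    then have X2: "2 \<le> X" using inv by simp
    then have log1: "1 \<le> log 2 X" by simp
    have "log 2 (1 / \<delta>\<^sup>2) \<le> log 2 (2 * X)" using inv \<delta>2 X2 by simp
    also have "\<dots> = 1 + log 2 X" using X2 by (simp add: log_mult)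
    \<comment> \<open>The 4 collects the doubling of \<open>X\<close>, the rounding up, the extra
      halving and the first-level query; \<open>log 2 X \<ge> 1\<close> then turns it into a factor
      5.\<close>
    finally have "real (Suc (bisections \<delta>)) \<le> 4 + log 2 X"
      using log1 unfolding bisections_def by linarith
    also have "\<dots> \<le> 5 * log 2 X" using log1 by simp
    finally have "real n * real (Suc (bisections \<delta>)) \<le> real n * (5 * log 2 X)"
      by (rule mult_left_mono) simp
    also have "\<dots> = 5 / ln 2 * (real n * ln X)" by (simp add: log_def)
    finally have "real (n * Suc (bisections \<delta>)) \<le> 5 / ln 2 * (real n * ln X)"
      by (simp only: of_nat_mult)
    moreover have "0 \<le> 5 / ln 2 * (real n * ln X)" using X2 by simp
    ultimately show ?thesis unfolding X_def by (cases "n = 1") simp_all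
  qed
qed

end

theorem theorem2:
  "\<exists>LearnVal :: nat \<Rightarrow> real \<Rightarrow> real \<Rightarrow> algorithm. \<exists>C > 0 :: real.
     \<forall>(n::nat) (\<delta>::real) (B::real).
       n \<ge> 1 \<longrightarrow> \<delta> > 0 \<longrightarrow> 1 \<in> grid \<delta> \<longrightarrow> B > 0 \<longrightarrow>
       admissible n (LearnVal n \<delta> B) \<and>
       (\<forall>v :: nat \<Rightarrow> real. v \<in> {1..n} \<rightarrow> grid \<delta> \<longrightarrow> inj_on v {1..n} \<longrightarrow>
          (\<forall>q out. interaction n (\<lambda>x. dot n x v) B (LearnVal n \<delta> B) q out \<longrightarrow>
             real q \<le> C * (real n * ln ((1 - \<delta>) / \<delta>\<^sup>2)) \<and>
             (\<forall>i\<in>{1..n}. out i = Some (v i / least_value n v) \<or>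
                (out i = None \<and> always_bought n (\<lambda>x. dot n x v) B i))))"
proof (intro exI[of _ learn_val] exI[of _ "5 / ln 2"] conjI allI impI)
  fix n :: nat and \<delta> B :: real and v q out
  assume A: "n \<ge> 1" "\<delta> > 0" "1 \<in> grid \<delta>" "B > 0" "v \<in> {1..n} \<rightarrow> grid \<delta>" "inj_on v {1..n}"
    and run: "interaction n (\<lambda>x. dot n x v) B (learn_val n \<delta> B) q out"
  interpret consumer n \<delta> B v using A by unfold_locales auto
  have q: "q \<le> (if n = 1 then 0 else n * Suc (bisections \<delta>))" and out: "right_output out"
    using correct_learn_val run by (auto simp: correct_def)
  show "real q \<le> 5 / ln 2 * (real n * ln ((1 - \<delta>) / \<delta>\<^sup>2))"
    using q query_bound[OF A(3)] by (meson of_nat_mono order_trans)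
  show "\<forall>i\<in>{1..n}. out i = Some (v i / least_value n v) \<or>
      (out i = None \<and> always_bought n (\<lambda>x. dot n x v) B i)"
    using out by (simp add: right_output_def)
qed (simp_all add: admissible_learn_val)

end
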